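(* Let $R>0$, let $B_r$ denote the ball of radius $r$ centered at the origin in $\mathbb{R}^2$, and let $\psi\in C^{0,1}(\mathbb{R}^2\setminus B_R)$ be a strictly decreasing radial function satisfying $$\int_{\partial B_r}|\nabla\psi|\,ds\le 8\pi-\int_{\mathbb{R}^2\setminus B_r}e^{\psi}\,dx\quad\text{for a.e. }r\in(R,\infty),\qquad\text{and}\qquad\int_{\mathbb{R}^2\setminus B_R}e^{\psi}\,dx<8\pi.$$ Then $$\left(\int_{\partial B_R}e^{\psi/2}\,ds\right)^2\le\frac12\left(\int_{\mathbb{R}^2\setminus B_R}e^{\psi}\,dx\right)\left(8\pi-\int_{\mathbb{R}^2\setminus B_R}e^{\psi}\,dx\right).$$ Moreover, if it is not the case that $\int_{\partial B_r}|\nabla\psi|\,ds=8\pi-\int_{\mathbb{R}^2\setminus B_r}e^{\psi}\,dx$ for a.e. $r\in(R,\infty)$, then the last inequality is strict.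
   Context: $C^{0,1}$ denotes Lipschitz continuous functions. A radial function $\psi$ is (strictly) decreasing if it is (strictly) decreasing as a function of $r=|x|$; for a.e. $r$ one has $\int_{\partial B_r}|\nabla\psi|\,ds=2\pi r|\psi'(r)|$. *)

theory Defs
  imports "HOL-Analysis.Analysis"
begin

text \<open>The arc-length integral of \<open>f\<close> over the circle \<open>\<partial>B\<^sub>r\<close> in the plane (for \<open>r > 0\<close>), with
  \<open>ds = r dt\<close>.\<close>

definition circle_integral :: "real \<Rightarrow> (real ^ 2 \<Rightarrow> real) \<Rightarrow> real" where
  "circle_integral r f = (LBINT t:{0..2 * pi}. f (vector [r * cos t, r * sin t]) * r)"

text \<open>Junk value at points where \<open>f\<close> is not differentiable.\<close>

definition grad :: "('a::real_inner \<Rightarrow> real) \<Rightarrow> 'a \<Rightarrow> 'a" where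
  "grad f x = (THE D. GDERIV f x :> D)"

definition strictly_decreasing_radial_on ::
    "'a::real_normed_vector set \<Rightarrow> ('a \<Rightarrow> real) \<Rightarrow> bool" where
  "strictly_decreasing_radial_on S f \<longleftrightarrow>
     (\<exists>g. (\<forall>x\<in>S. f x = g (norm x)) \<and> strict_antimono_on (norm ` S) g)"

end

theory Submission
  imports Defs "HOL-Real_Asymp.Real_Asymp"
begin

text \<open>
  Write \<open>\<psi> x = g \<bar>x\<bar>\<close> and let \<open>F r\<close> be the integral of \<open>e\<^sup>\<psi>\<close> outside the ball of radius \<open>r\<close>, so that
  \<open>F' r = - 2\<pi> r e\<^bsup>g r\<^esup>\<close>. The function \<open>P r = F r (8\<pi> - F r) / 2 - 4\<pi>\<^sup>2 r\<^sup>2 e\<^bsup>g r\<^esup>\<close> has the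
  almost everywhere derivative \<open>2\<pi> r e\<^bsup>g r\<^esup> (F r - 8\<pi> - 2\<pi> r g' r)\<close>, which is nonpositive exactly by
  the hypothesis on the flux of \<open>\<psi>\<close>. Hence \<open>P\<close> is antimonotone, and since it vanishes at infinity,
  \<open>P R \<ge> 0\<close>, which is the claim. If \<open>P R = 0\<close>, then \<open>P\<close> vanishes identically, so its derivative
  does, and the hypothesis holds with equality almost everywhere.

  The gradient of \<open>\<psi>\<close> is meaningful only where \<open>g\<close> is differentiable, so the argument needs
  Lebesgue's theorem that a monotone Lipschitz function is differentiable almost everywhere.
  A Dini derivative above \<open>v\<close> on a closed set \<open>K\<close> makes the function grow at least by \<open>v\<close> times the
  measure of \<open>K\<close>; if the upper and lower derivates differ on \<open>K\<close>, the resulting upper and lower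
  bounds let \<open>K\<close> fill at most a fixed fraction less than \<open>1\<close> of every interval, so \<open>K\<close> is negligible.
\<close>

section \<open>Differentiability of monotone Lipschitz functions\<close>

text \<open>A level outside \<open>P ` N\<close> is last attained at a point outside \<open>N\<close>.\<close>

lemma le_if_frequently_increasing_right:
  fixes P :: "real \<Rightarrow> real"
  assumes "a \<le> b" and cont: "continuous_on {a..b} P" and neg: "negligible (P ` N)"
    and inc: "\<And>x. a < x \<Longrightarrow> x < b \<Longrightarrow> x \<notin> N \<Longrightarrow> \<exists>\<^sub>F h in at_right 0. P x < P (x + h)"
  shows "P a \<le> P b"
proof (rule ccontr)
  assume "\<not> P a \<le> P b"
  then have "\<not> negligible {P b<..<P a}"
    using open_not_negligible[of "{P b<..<P a}"] by simp
  then obtain y where y: "P b < y" "y < P a" "y \<notin> P ` N"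
    using neg negligible_subset by (metis greaterThanLessThan_iff subsetI)
  define S where "S = {a..b} \<inter> P -` {y..}"
  have "closed S"
    unfolding S_def by (rule continuous_closed_preimage[OF cont]) auto
  moreover have "bounded S"
    by (rule bounded_subset[of "{a..b}"]) (auto simp: S_def)
  ultimately have "compact S"
    using compact_eq_bounded_closed by blast
  moreover have "a \<in> S"
    using y \<open>a \<le> b\<close> by (auto simp: S_def)
  ultimately obtain c where c: "c \<in> S" "\<And>x. x \<in> S \<Longrightarrow> x \<le> c"
    using compact_attains_sup[of S] by blast
  have cab: "a \<le> c" "c < b" "y \<le> P c"
    using c(1) y by (auto simp: S_def less_le)
  have Pc: "P c = y"
  proof (rule ccontr)
    assume "P c \<noteq> y"
    obtain x where "c \<le> x" "x \<le> b" "P x = y"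
      using IVT2'[of P b y c] cab y continuous_on_subset[OF cont, of "{c..b}"] by auto
    then show False
      using c(2)[of x] cab \<open>P c \<noteq> y\<close> by (auto simp: S_def)
  qed
  have "a < c"
    using y Pc cab by (auto simp: less_le)
  have "\<forall>\<^sub>F h in at_right 0. \<not> P c < P (c + h)"
    using eventually_at_right_real[of 0 "b - c"]
  proof (rule eventually_mono)
    fix h assume "h \<in> {0<..<b - c}"
    then have "c + h \<notin> S"
      using c(2)[of "c + h"] by auto
    then show "\<not> P c < P (c + h)"
      using \<open>h \<in> _\<close> cab Pc by (auto simp: S_def)
  qed (use cab in simp)
  moreover have "\<exists>\<^sub>F h in at_right 0. P c < P (c + h)"
    using inc[of c] \<open>a < c\<close> \<open>c < b\<close> y(3) Pc by blast
  ultimately show False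
    by (simp add: frequently_def)
qed

text \<open>For \<open>s = -1\<close>, the reflection \<open>\<lambda>x. - P (- x)\<close> swaps
  left and right and reduces the claim to the right-sided case.\<close>

lemma le_if_frequently_increasing:
  fixes P :: "real \<Rightarrow> real" and s :: real
  assumes "a \<le> b" and cont: "continuous_on {a..b} P" and s: "s = 1 \<or> s = -1"
    and inc: "\<And>x. a < x \<Longrightarrow> x < b \<Longrightarrow> \<exists>\<^sub>F h in at_right 0. 0 < s * (P (x + s * h) - P x)"
  shows "P a \<le> P b"
  using s
proof
  assume "s = 1"
  then show ?thesis
    using le_if_frequently_increasing_right[OF assms(1,2), of "{}"] inc by simp
next
  assume "s = -1"
  have "- P (- (- b)) \<le> - P (- (- a))"
  proof (rule le_if_frequently_increasing_right[where P = "\<lambda>x. - P (- x)" and N = "{}"])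
    show "continuous_on {- b..- a} (\<lambda>x. - P (- x))"
      by (intro continuous_intros continuous_on_compose2[OF cont]) auto
    show "\<exists>\<^sub>F h in at_right 0. - P (- x) < - P (- (x + h))" if "- b < x" "x < - a" for x
      using inc[of "- x"] that \<open>s = -1\<close> by simp
  qed (use assms(1) in auto)
  then show ?thesis by simp
qed

section \<open>Growth forced by Dini derivates on closed sets\<close>

text \<open>The sign \<open>s = \<plusminus>1\<close> selects right or left difference quotients.\<close>

definition dini_set :: "real \<Rightarrow> real \<Rightarrow> (real \<Rightarrow> real) \<Rightarrow> real set" where
  "dini_set s v f = {x. \<exists>\<^sub>F h in at_right 0. v * h < s * (f (x + s * h) - f x)}"

text \<open>Subtracting \<open>v\<close> times the measure of \<open>K \<inter> {a..x}\<close> from \<open>f x\<close> leaves a monotone function: off the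
  closed set \<open>K\<close> that measure is locally constant, and on \<open>K\<close> its slope is at most \<open>1\<close>.\<close>

lemma dini_set_growth:
  fixes f :: "real \<Rightarrow> real"
  assumes mono: "mono f" and cont: "continuous_on UNIV f" and s: "s = 1 \<or> s = -1"
    and K: "closed K" "K \<subseteq> dini_set s v f" and "a \<le> b"
  shows "v * measure lebesgue (K \<inter> {a..b}) \<le> f b - f a"
proof (cases "v \<le> 0")
  case True
  then have "v * measure lebesgue (K \<inter> {a..b}) \<le> 0"
    by (simp add: mult_nonpos_nonneg)
  then show ?thesis
    using monoD[OF mono \<open>a \<le> b\<close>] by simp
next
  case False
  define k where "k x = measure lebesgue (K \<inter> {a..x})" for x
  have meas: "K \<inter> {c..d} \<in> lmeasurable" for c d
    using lmeasurable_compact[of "K \<inter> {c..d}"] K(1) by (simp add: closed_Int_compact)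
  have k_split: "k y = k x + measure lebesgue (K \<inter> {x..y})" if "a \<le> x" "x \<le> y" for x y
  proof -
    have "measure lebesgue ((K \<inter> {a..x}) \<union> (K \<inter> {x..y})) =
        measure lebesgue (K \<inter> {a..x}) + measure lebesgue (K \<inter> {x..y})"
    proof -
      have "negligible ((K \<inter> {a..x}) \<inter> (K \<inter> {x..y}))"
        by (rule negligible_subset[of "{x}"]) auto
      then show ?thesis
        using measure_Un3[OF meas meas, of a x x y] negligible_imp_measure0 by simp
    qed
    moreover have "(K \<inter> {a..x}) \<union> (K \<inter> {x..y}) = K \<inter> {a..y}"
      using that by auto
    ultimately show ?thesis by (simp add: k_def)
  qed
  have k_le: "\<bar>k y - k x\<bar> \<le> \<bar>y - x\<bar>" if "a \<le> x" "a \<le> y" for x y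
  proof -
    have *: "\<bar>k y - k x\<bar> \<le> \<bar>y - x\<bar>" if "a \<le> x" "x \<le> y" for x y
    proof -
      have "measure lebesgue (K \<inter> {x..y}) \<le> measure lebesgue {x..y}"
        by (rule measure_mono_fmeasurable) (use meas[of x y] in \<open>auto\<close>)
      then show ?thesis
        using k_split[OF that] that by simp
    qed
    then show ?thesis
      using *[of x y] *[of y x] that by (cases x y rule: le_cases) (simp_all add: abs_minus_commute)
  qed
  \<comment> \<open>Off \<open>K\<close> the function \<open>f\<close> may be locally constant, so
    only the extra term \<open>e * x\<close> makes the increments strictly positive there;
    \<open>e\<close> tends to 0 at the end.\<close>
  have "f a - v * k a + e * a \<le> f b - v * k b + e * b" if "e > 0" for e
  proof (rule le_if_frequently_increasing[OF \<open>a \<le> b\<close> _ s, of "\<lambda>x. f x - v * k x + e * x"])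
    have "continuous_on {a..b} k"
      by (rule continuous_onI) (use k_le in \<open>force simp: dist_real_def intro: le_less_trans\<close>)
    then show "continuous_on {a..b} (\<lambda>x. f x - v * k x + e * x)"
      by (intro continuous_intros continuous_on_subset[OF cont]) auto
    fix x assume x: "a < x" "x < b"
    \<comment> \<open>Keeping \<open>h < x - a\<close> ensures that \<open>x - h\<close> stays to
      the right of \<open>a\<close>, as \<open>k_le\<close> and \<open>k_split\<close>
      require.\<close>
    have ev: "\<forall>\<^sub>F h in at_right 0. h \<in> {0<..<x - a}"
      using x by (intro eventually_at_right_real) simp
    let ?D = "\<lambda>h. f (x + s * h) - v * k (x + s * h) + e * (x + s * h) - (f x - v * k x + e * x)"
    show "\<exists>\<^sub>F h in at_right 0. 0 < s * ?D h"
    proof (cases "x \<in> K")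
      case True
      then have "\<exists>\<^sub>F h in at_right 0. v * h < s * (f (x + s * h) - f x)"
        using K(2) by (auto simp: dini_set_def)
      then show ?thesis
      proof (rule frequently_rev_mp)
        show "\<forall>\<^sub>F h in at_right 0. v * h < s * (f (x + s * h) - f x) \<longrightarrow>
           0 < s * ?D h"
          using ev
        proof (rule eventually_mono, intro impI)
          fix h assume h: "h \<in> {0<..<x - a}" "v * h < s * (f (x + s * h) - f x)"
          have "\<bar>k (x + s * h) - k x\<bar> \<le> \<bar>s * h\<bar>"
            using k_le[of x "x + s * h"] s h x by auto
          then have "s * (k (x + s * h) - k x) \<le> h"
            using s h by auto
          then have "v * (s * (k (x + s * h) - k x)) \<le> v * h"
            using False by (intro mult_left_mono) auto
          moreover have "0 < e * (s * s) * h"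
            using s h \<open>e > 0\<close> by auto
          ultimately show "0 < s * ?D h"
            using h(2) by (simp add: algebra_simps)
        qed
      qed
    next
      case False
      then obtain d where d: "d > 0" "ball x d \<subseteq> - K"
        using K(1) by (meson ComplI open_Compl open_contains_ball)
      have "\<forall>\<^sub>F h in at_right 0. h \<in> {0<..<min (x - a) d}"
        using x d by (intro eventually_at_right_real) simp
      then have "\<forall>\<^sub>F h in at_right 0. 0 < s * ?D h"
      proof (rule eventually_mono)
        fix h assume h: "h \<in> {0<..<min (x - a) d}"
        have e1: "K \<inter> {x..x + h} = {}" "K \<inter> {x - h..x} = {}"
          using d h by (force simp: dist_real_def subset_eq)+
        have "k (x + s * h) = k x"
          using s k_split[of x "x + h"] k_split[of "x - h" x] h x e1 by auto
        moreover have "0 \<le> s * (f (x + s * h) - f x)"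
          using s h monoD[OF mono, of x "x + h"] monoD[OF mono, of "x - h" x] by auto
        moreover have "0 < e * (s * s) * h"
          using s h \<open>e > 0\<close> by auto
        ultimately show "0 < s * ?D h"
          by (simp add: algebra_simps)
      qed
      then show ?thesis
        by (rule eventually_frequently[rotated]) simp
    qed
  qed
  then have *: "v * k b - v * k a \<le> f b - f a + e * (b - a)" if "e > 0" for e
    unfolding right_diff_distrib using that by fastforce
  have "v * k b - v * k a \<le> f b - f a"
  proof (rule field_le_epsilon)
    fix e :: real assume "e > 0"
    \<comment> \<open>The \<open>+ 1\<close> keeps the slope well defined and positive when
      \<open>a = b\<close>.\<close>
    have "e / (b - a + 1) * (b - a) \<le> e"
      using \<open>e > 0\<close> \<open>a \<le> b\<close> by (simp add: field_simps)
    then show "v * k b - v * k a \<le> f b - f a + e"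
      using *[of "e / (b - a + 1)"] \<open>e > 0\<close> \<open>a \<le> b\<close> by simp
  qed
  moreover have "k a = 0"
    using negligible_subset[of "{a}" "K \<inter> {a..a}"] by (auto simp: k_def intro!: negligible_imp_measure0)
  ultimately show ?thesis
    by (simp add: k_def)
qed

text \<open>Cover \<open>S\<close> by countably many nonoverlapping intervals of total measure at
  most \<open>measure lebesgue S + e\<close>. Summing the sparsity bound over them gives
  \<open>measure lebesgue S \<le> c * (measure lebesgue S + e)\<close>, which for
  \<open>c < 1\<close> and small \<open>e\<close> forces measure 0. This takes the place of the
  Lebesgue density theorem.\<close>

lemma negligible_if_uniformly_sparse:
  fixes S :: "real set"
  assumes S: "S \<in> lmeasurable" "bounded S" and "c < 1"
    and sparse: "\<And>a b. a \<le> b \<Longrightarrow> measure lebesgue (S \<inter> {a..b}) \<le> c * (b - a)"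
  shows "negligible S"
proof -
  obtain a b where ab: "S \<subseteq> cbox a b"
    using bounded_subset_cbox_symmetric[OF S(2)] by blast
  have "c \<ge> 0"
    using order_trans[OF measure_nonneg sparse[of 0 1]] by simp
  have "measure lebesgue S \<le> c * (measure lebesgue S + e)" if "e > 0" for e
  proof -
    obtain \<D> where D: "countable \<D>"
        "\<And>K. K \<in> \<D> \<Longrightarrow> K \<subseteq> cbox a b \<and> K \<noteq> {} \<and> (\<exists>c d. K = cbox c d)"
        "pairwise (\<lambda>A B. interior A \<inter> interior B = {}) \<D>"
        "S \<subseteq> \<Union>\<D>" "\<Union>\<D> \<in> lmeasurable" "measure lebesgue (\<Union>\<D>) \<le> measure lebesgue S + e"
      using measurable_outer_intervals_bounded[OF S(1) ab \<open>e > 0\<close>] by metis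
    have meas: "K \<in> lmeasurable" if "K \<in> \<D>" for K
      using D(2)[OF that] by auto
    \<comment> \<open>It suffices to bound the measure of every finite subunion by the same
      constant; the countable union inherits the bound.\<close>
    have "measure lebesgue (\<Union>K\<in>\<D>. S \<inter> K) \<le> c * (measure lebesgue S + e)"
    proof (rule measure_UN_bound[OF D(1)])
      show "S \<inter> K \<in> lmeasurable" if "K \<in> \<D>" for K
        using S(1) meas[OF that] by (rule fmeasurable.Int)
      fix \<E> assume E: "\<E> \<subseteq> \<D>" "finite \<E>"
      have "measure lebesgue (\<Union>K\<in>\<E>. S \<inter> K) \<le> (\<Sum>K\<in>\<E>. measure lebesgue (S \<inter> K))"
        using E S meas by (intro measure_UNION_le) (auto)
      also have "\<dots> \<le> (\<Sum>K\<in>\<E>. c * measure lebesgue K)"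
      proof (rule sum_mono)
        fix K assume "K \<in> \<E>"
        then obtain p q where "K = {p..q}" "p \<le> q"
          using D(2)[of K] E(1) by fastforce
        then show "measure lebesgue (S \<inter> K) \<le> c * measure lebesgue K"
          using sparse[of p q] by simp
      qed
      also have "\<dots> = c * measure lebesgue (\<Union>\<E>)"
      proof -
        have "measure lebesgue (\<Union>\<E>) = (\<Sum>K\<in>\<E>. measure lebesgue K)"
        proof (rule measure_negligible_finite_Union[OF E(2)])
          show "pairwise (\<lambda>S T. negligible (S \<inter> T)) \<E>"
          proof (rule pairwiseI)
            fix A B assume AB: "A \<in> \<E>" "B \<in> \<E>" "A \<noteq> B"
            then obtain p q p' q' where *: "A = cbox p q" "B = cbox p' q'"
              using D(2) E(1) by (metis subsetD)
            have "interior A \<inter> interior B = {}"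
              using D(3) AB E(1) by (auto simp: pairwise_def)
            then show "negligible (A \<inter> B)"
              unfolding * by (simp add: negligible_convex_interior convex_Int)
          qed
        qed (use E meas in auto)
        then show ?thesis
          by (simp add: sum_distrib_left)
      qed
      also have "\<dots> \<le> c * measure lebesgue (\<Union>\<D>)"
        using E(1) D(5) \<open>c \<ge> 0\<close> fmeasurableD[OF meas]
        by (intro mult_left_mono measure_mono_fmeasurable sets.finite_Union[OF E(2)] Union_mono) auto
      also have "\<dots> \<le> c * (measure lebesgue S + e)"
        using D(6) \<open>c \<ge> 0\<close> by (rule mult_left_mono)
      finally show "measure lebesgue (\<Union>K\<in>\<E>. S \<inter> K) \<le> c * (measure lebesgue S + e)" .
    qed
    moreover have "(\<Union>K\<in>\<D>. S \<inter> K) = S"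
      using D(4) by auto
    ultimately show ?thesis by simp
  qed
  then have *: "(1 - c) * measure lebesgue S \<le> c * e" if "e > 0" for e
    using that by (force simp: algebra_simps)
  have "(1 - c) * measure lebesgue S \<le> 0"
  proof (rule field_le_epsilon)
    \<comment> \<open>Dividing by \<open>c + 1\<close> instead of \<open>c\<close> covers
      \<open>c = 0\<close>.\<close>
    fix e :: real assume "e > 0"
    then show "(1 - c) * measure lebesgue S \<le> 0 + e"
      using *[of "e / (c + 1)"] \<open>c \<ge> 0\<close> mult_right_mono[of c "c + 1" "e / (c + 1)"] by simp
  qed
  then have "measure lebesgue S = 0"
    using \<open>c < 1\<close> measure_nonneg[of lebesgue S] by (simp add: mult_le_0_iff)
  then show ?thesis
    using S(1) negligible_iff_measure by blast
qed


text \<open>Having such \<open>h\<close> frequently near 0 means having one below each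
  \<open>inverse (Suc n)\<close>. By continuity each of these conditions is open in
  \<open>x\<close>, so the set is a countable intersection of open sets.\<close>

lemma dini_set_borel:
  assumes "continuous_on UNIV f"
  shows "dini_set s v f \<in> sets borel"
proof -
  define U where "U n = (\<Union>h\<in>{0<..<inverse (real (Suc n))}. {x. v * h < s * (f (x + s * h) - f x)})" for n
  have "open (U n)" for n
    unfolding U_def
    by (intro open_UN ballI open_Collect_less continuous_intros continuous_on_compose2[OF assms]) auto
  moreover have "dini_set s v f = (\<Inter>n. U n)"
  proof (intro equalityI subsetI INT_I)
    fix x n assume "x \<in> dini_set s v f"
    then have "\<exists>\<^sub>F h in at_right 0. v * h < s * (f (x + s * h) - f x)"
      by (simp add: dini_set_def)
    moreover have "\<forall>\<^sub>F h in at_right 0. h \<in> {0<..<inverse (real (Suc n))}"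
      by (intro eventually_at_right_real) simp
    ultimately have "\<exists>\<^sub>F h in at_right 0. v * h < s * (f (x + s * h) - f x) \<and> h \<in> {0<..<inverse (real (Suc n))}"
      by (rule frequently_eventually_frequently)
    then obtain h where "v * h < s * (f (x + s * h) - f x)" "h \<in> {0<..<inverse (real (Suc n))}"
      using frequently_ex by blast
    then show "x \<in> U n"
      unfolding U_def by blast
  next
    fix x assume x: "x \<in> (\<Inter>n. U n)"
    show "x \<in> dini_set s v f"
      unfolding dini_set_def mem_Collect_eq frequently_def
    proof
      assume "\<forall>\<^sub>F h in at_right 0. \<not> v * h < s * (f (x + s * h) - f x)"
      then obtain b where b: "b > 0" "\<And>h. 0 < h \<Longrightarrow> h < b \<Longrightarrow> \<not> v * h < s * (f (x + s * h) - f x)"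
        by (auto simp: eventually_at_right_field)
      obtain n where "inverse (real (Suc n)) < b"
        using reals_Archimedean[OF b(1)] by auto
      moreover obtain h where "0 < h" "h < inverse (real (Suc n))" "v * h < s * (f (x + s * h) - f x)"
        using INT_D[OF x UNIV_I, of n] unfolding U_def by (auto simp del: of_nat_Suc)
      ultimately show False
        using b(2)[of h] by linarith
    qed
  qed
  ultimately show ?thesis by auto
qed

text \<open>A lower derivate of \<open>f\<close> below \<open>u\<close> is an upper derivate of \<open>L x - f x\<close> above \<open>L - u\<close>.\<close>

lemma negligible_dini_gap:
  fixes f :: "real \<Rightarrow> real"
  assumes mono: "mono f" and lip: "L-lipschitz_on UNIV f" and "u < v"
    and s: "s = 1 \<or> s = -1" and t: "t = 1 \<or> t = -1"
  shows "negligible (dini_set s v f \<inter> dini_set t (L - u) (\<lambda>x. L * x - f x))" (is "negligible ?E")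
proof (rule negligible_on_intervals[THEN iffD2], intro allI)
  fix a b
  note cont = lipschitz_on_continuous_on[OF lip]
  have cont': "continuous_on UNIV (\<lambda>x. L * x - f x)"
    by (intro continuous_intros cont)
  \<comment> \<open>The Lipschitz bound makes \<open>L * x - f x\<close> monotone as well, so
    \<open>dini_set_growth\<close> applies to both functions.\<close>
  have mono': "mono (\<lambda>x. L * x - f x)"
  proof (rule monoI)
    fix x y :: real assume "x \<le> y"
    then have "\<bar>f y - f x\<bar> \<le> L * (y - x)"
      using lipschitz_onD[OF lip, of y x] by (simp add: dist_real_def)
    then show "L * x - f x \<le> L * y - f y"
      by (simp add: algebra_simps)
  qed
  have L: "L \<ge> 0"
    using lip by (rule lipschitz_on_nonneg)
  have E: "?E \<inter> cbox a b \<in> sets lebesgue"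
    using dini_set_borel[OF cont, of s v] dini_set_borel[OF cont', of t "L - u"] by auto
  \<comment> \<open>Adding the growth bounds with slopes \<open>v\<close> and \<open>L - u\<close>
    cancels the increments of \<open>f\<close> and leaves \<open>(L + v - u) * measure lebesgue (T
    \<inter> {p..q}) \<le> L * (q - p)\<close>, hence the ratio \<open>c\<close>.\<close>
  have null: "negligible T" if T: "closed T" "T \<subseteq> ?E \<inter> cbox a b" for T
  proof (rule negligible_if_uniformly_sparse[where c = "L / (L + v - u)"])
    show "bounded T"
      using T(2) bounded_cbox bounded_subset by blast
    then show "T \<in> lmeasurable"
      using T(1) compact_eq_bounded_closed lmeasurable_compact by blast
    show "L / (L + v - u) < 1"
      using L \<open>u < v\<close> by simp
    fix p q :: real assume "p \<le> q"
    have "v * measure lebesgue (T \<inter> {p..q}) \<le> f q - f p"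
      using T by (intro dini_set_growth[OF mono cont s _ _ \<open>p \<le> q\<close>]) auto
    moreover have "(L - u) * measure lebesgue (T \<inter> {p..q}) \<le> (L * q - f q) - (L * p - f p)"
      using T by (intro dini_set_growth[OF mono' cont' t _ _ \<open>p \<le> q\<close>]) auto
    ultimately show "measure lebesgue (T \<inter> {p..q}) \<le> L / (L + v - u) * (q - p)"
      using L \<open>u < v\<close> by (simp add: field_simps)
  qed
  \<comment> \<open>Inner regularity: a closed subset exhausts the set up to measure
    \<open>e\<close>, and closed subsets are null, so the set itself has measure below
    \<open>e\<close>.\<close>
  show "negligible (?E \<inter> cbox a b)"
  proof (rule negligible_outer[THEN iffD2], intro allI impI)
    fix e :: real assume "e > 0"
    obtain T where T: "closed T" "T \<subseteq> ?E \<inter> cbox a b" "?E \<inter> cbox a b - T \<in> lmeasurable"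
        "emeasure lebesgue (?E \<inter> cbox a b - T) < ennreal e"
      by (rule sets_lebesgue_inner_closed[OF E \<open>e > 0\<close>])
    have "measure lebesgue ((?E \<inter> cbox a b - T) \<union> T) = measure lebesgue (?E \<inter> cbox a b - T)"
      using null[OF T(1,2)] T(3) by (intro measure_Un_null_set) (auto simp: negligible_iff_null_sets)
    moreover have "(?E \<inter> cbox a b - T) \<union> T = ?E \<inter> cbox a b"
      using T(2) by auto
    moreover have "measure lebesgue (?E \<inter> cbox a b - T) < e"
      using T(3,4) \<open>e > 0\<close> by (simp add: emeasure_eq_measure2 ennreal_less_iff)
    moreover have "?E \<inter> cbox a b \<in> lmeasurable"
      by (rule bounded_set_imp_lmeasurable[OF bounded_subset[OF bounded_cbox inf_le2] E])
    ultimately show "\<exists>T. ?E \<inter> cbox a b \<subseteq> T \<and> T \<in> lmeasurable \<and> measure lebesgue T < e"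
      by (intro exI[of _ "?E \<inter> cbox a b"]) simp
  qed
qed

text \<open>The limit is the lower limit of \<open>q\<close>, obtained as the supremum of its
  eventual strict lower bounds; an upper limit above it would leave a rational gap. Rational levels
  suffice by density and keep the exceptional sets countable in number.\<close>

lemma convergent_if_no_rational_gap:
  fixes q :: "'a \<Rightarrow> real"
  assumes "F \<noteq> bot" and bnd: "\<forall>\<^sub>F x in F. \<bar>q x\<bar> \<le> L"
    and gap: "\<And>u v. u \<in> \<rat> \<Longrightarrow> v \<in> \<rat> \<Longrightarrow> u < v \<Longrightarrow> \<exists>\<^sub>F x in F. v < q x \<Longrightarrow> \<forall>\<^sub>F x in F. u \<le> q x"
  obtains l where "(q \<longlongrightarrow> l) F"
proof -
  define S where "S = {u. \<forall>\<^sub>F x in F. u < q x}"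
  have "- L - 1 \<in> S"
    using bnd by (auto simp: S_def elim: eventually_mono)
  moreover have bdd: "u \<le> L" if "u \<in> S" for u
  proof -
    have "\<forall>\<^sub>F x in F. u \<le> L"
      using that bnd unfolding S_def mem_Collect_eq by eventually_elim simp
    then show ?thesis
      using \<open>F \<noteq> bot\<close> by simp
  qed
  ultimately have S: "S \<noteq> {}" "bdd_above S"
    by (blast, meson bdd_aboveI)
  have "(q \<longlongrightarrow> Sup S) F"
  proof (rule order_tendstoI)
    fix a assume "a < Sup S"
    then obtain u where "u \<in> S" "a < u"
      using less_cSup_iff[OF S] by auto
    then show "\<forall>\<^sub>F x in F. a < q x"
      by (auto simp: S_def elim: eventually_mono)
  next
    fix a assume "Sup S < a"
    then obtain v where v: "v \<in> \<rat>" "Sup S < v" "v < a"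
      using Rats_dense_in_real by blast
    then obtain u where u: "u \<in> \<rat>" "Sup S < u" "u < v"
      using Rats_dense_in_real by blast
    \<comment> \<open>An eventual bound \<open>u \<le> q x\<close> is not strict; lowering it to
      \<open>w\<close>, still above \<open>Sup S\<close>, gives a member of \<open>S\<close> and a
      contradiction.\<close>
    obtain w where w: "Sup S < w" "w < u"
      using u dense by blast
    have "\<not> (\<forall>\<^sub>F x in F. u \<le> q x)"
    proof
      assume "\<forall>\<^sub>F x in F. u \<le> q x"
      then have "w \<in> S"
        using w by (auto simp: S_def elim: eventually_mono)
      then show False
        using cSup_upper[OF _ S(2)] w by fastforce
    qed
    then have "\<not> (\<exists>\<^sub>F x in F. v < q x)"
      using gap u v by blast
    then show "\<forall>\<^sub>F x in F. q x < a"
      using v by (auto simp: not_frequently elim!: eventually_mono)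
  qed
  then show ?thesis by (rule that)
qed

text \<open>Both sides of 0 are expressed by a sign and a positive \<open>h\<close>, the form used
  in \<open>dini_set\<close>.\<close>

lemma frequently_at_0_iff:
  "(\<exists>\<^sub>F h::real in at 0. P h) \<longleftrightarrow> (\<exists>s\<in>{1, -1}. \<exists>\<^sub>F h in at_right 0. P (s * h))"
  by (simp add: frequently_def eventually_at_split eventually_at_left_to_right disj_commute)

lemma mono_lipschitz_differentiable_ae:
  fixes f :: "real \<Rightarrow> real"
  assumes mono: "mono f" and lip: "L-lipschitz_on UNIV f"
  shows "negligible {x. \<not> f differentiable at x}"
proof -
  \<comment> \<open>Any upper derivate exceeding a lower derivate, on the same or on opposite sides
    of the point, is separated from it by rationals \<open>u < v\<close> and so puts the point in
    \<open>B\<close>. The union is countable.\<close>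
  define B where "B = (\<Union>(u, v)\<in>\<rat> \<times> \<rat> \<inter> {(u, v). u < v}. \<Union>s\<in>{1, -1}. \<Union>t\<in>{1, -1}.
      dini_set s v f \<inter> dini_set t (L - u) (\<lambda>x. L * x - f x))"
  have "negligible B"
    unfolding B_def using negligible_dini_gap[OF mono lip]
    by (intro negligible_countable_Union countable_image countable_Int1 countable_SIGMA countable_rat) auto
  moreover have "f differentiable at x" if "x \<notin> B" for x
  proof -
    define q where "q h = (f (x + h) - f x) / h" for h
    obtain l where "(q \<longlongrightarrow> l) (at 0)"
    proof (rule convergent_if_no_rational_gap)
      have "\<bar>q h\<bar> \<le> L" if "h \<noteq> 0" for h
        using lipschitz_onD[OF lip, of "x + h" x] that by (simp add: q_def dist_real_def field_simps)
      then show "\<forall>\<^sub>F h in at 0. \<bar>q h\<bar> \<le> L"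
        by (auto simp: eventually_at_filter)
      fix u v :: real assume uv: "u \<in> \<rat>" "v \<in> \<rat>" "u < v" and "\<exists>\<^sub>F h in at 0. v < q h"
      then obtain s where s: "s \<in> {1, -1}" "\<exists>\<^sub>F h in at_right 0. v < q (s * h)"
        unfolding frequently_at_0_iff by blast
      have pos: "\<forall>\<^sub>F h in at_right 0. (0::real) < h"
        by (rule eventually_at_right_less)
      have "x \<in> dini_set s v f"
        unfolding dini_set_def mem_Collect_eq using s(2)
        by (rule frequently_rev_mp)
          (use pos s(1) in \<open>auto elim!: eventually_mono simp: q_def field_simps\<close>)
      then have no: "x \<notin> dini_set t (L - u) (\<lambda>x. L * x - f x)" if "t \<in> {1, -1}" for t
        using \<open>x \<notin> B\<close> s(1) uv that unfolding B_def by blast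
      show "\<forall>\<^sub>F h in at 0. u \<le> q h"
      proof (rule ccontr)
        assume "\<not> (\<forall>\<^sub>F h in at 0. u \<le> q h)"
        then have "\<exists>\<^sub>F h in at 0. q h < u"
          by (simp add: frequently_def not_less)
        then obtain t where t: "t \<in> {1, -1}" "\<exists>\<^sub>F h in at_right 0. q (t * h) < u"
          unfolding frequently_at_0_iff by blast
        have "x \<in> dini_set t (L - u) (\<lambda>x. L * x - f x)"
          unfolding dini_set_def mem_Collect_eq using t(2)
          by (rule frequently_rev_mp)
            (use pos t(1) in \<open>auto elim!: eventually_mono simp: q_def field_simps\<close>)
        then show False
          using no t(1) by blast
      qed
    qed simp
    then have "(f has_field_derivative l) (at x)"
      unfolding DERIV_def q_def .
    then show ?thesis
      by (rule real_differentiable_def[THEN iffD2, OF exI])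
  qed
  ultimately show ?thesis
    by (blast intro: negligible_subset[of B])
qed

section \<open>Monotonicity from the sign of the derivative almost everywhere\<close>

text \<open>Only increments from the fixed point \<open>x\<close> are bounded, so the condition is
  weaker than being Lipschitz near \<open>x\<close> and holds wherever \<open>f\<close> is
  differentiable. It is still enough for null sets to have null images.\<close>

definition pointwise_lipschitz :: "(real \<Rightarrow> real) \<Rightarrow> real \<Rightarrow> bool" where
  "pointwise_lipschitz f x \<longleftrightarrow> (\<exists>B>0. \<forall>\<^sub>F y in nhds x. \<bar>f y - f x\<bar> \<le> B * \<bar>y - x\<bar>)"

lemma DERIV_imp_pointwise_lipschitz:
  assumes "(f has_real_derivative D) (at x)"
  shows "pointwise_lipschitz f x"
proof -
  have "((\<lambda>y. (f y - f x) / (y - x)) \<longlongrightarrow> D) (at x)"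
    using assms by (simp add: has_field_derivative_iff)
  then have "\<forall>\<^sub>F y in at x. dist ((f y - f x) / (y - x)) D < 1"
    by (rule tendstoD) simp
  then have "\<forall>\<^sub>F y in at x. \<bar>f y - f x\<bar> \<le> (\<bar>D\<bar> + 1) * \<bar>y - x\<bar>"
    using eventually_neq_at_within[of x]
  proof eventually_elim
    case (elim y)
    then have "\<bar>(f y - f x) / (y - x)\<bar> \<le> \<bar>D\<bar> + 1"
      unfolding dist_real_def by linarith
    then show ?case
      using elim by (simp add: field_simps)
  qed
  then have "\<forall>\<^sub>F y in nhds x. \<bar>f y - f x\<bar> \<le> (\<bar>D\<bar> + 1) * \<bar>y - x\<bar>"
    by (auto simp: eventually_at_filter elim!: eventually_mono)
  then show ?thesis
    unfolding pointwise_lipschitz_def by (intro exI[of _ "\<bar>D\<bar> + 1"]) auto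
qed

lemma lipschitz_imp_pointwise_lipschitz:
  assumes "L-lipschitz_on UNIV f"
  shows "pointwise_lipschitz f x"
  unfolding pointwise_lipschitz_def
proof (intro exI conjI always_eventually allI)
  show "L + 1 > 0"
    using lipschitz_on_nonneg[OF assms] by simp
  show "\<bar>f y - f x\<bar> \<le> (L + 1) * \<bar>y - x\<bar>" for y
    using lipschitz_onD[OF assms, of y x] by (simp add: dist_real_def algebra_simps)
qed

lemma pointwise_lipschitz_imp_tendsto:
  assumes "pointwise_lipschitz f x"
  shows "(f \<longlongrightarrow> f x) (nhds x)"
proof -
  obtain B where B: "\<forall>\<^sub>F y in nhds x. \<bar>f y - f x\<bar> \<le> B * \<bar>y - x\<bar>"
    using assms by (auto simp: pointwise_lipschitz_def)
  have "((\<lambda>y. B * \<bar>y - x\<bar>) \<longlongrightarrow> B * \<bar>x - x\<bar>) (nhds x)"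
    by (intro tendsto_intros filterlim_ident)
  then have "((\<lambda>y. f y - f x) \<longlongrightarrow> 0) (nhds x)"
    using Lim_null_comparison[of "\<lambda>y. f y - f x" "\<lambda>y. B * \<bar>y - x\<bar>" "nhds x"] B by simp
  then show ?thesis
    by (rule LIM_zero_cancel)
qed

lemma pointwise_lipschitz_diff:
  assumes "pointwise_lipschitz f x" "pointwise_lipschitz g x"
  shows "pointwise_lipschitz (\<lambda>y. f y - g y) x"
proof -
  obtain B C where "B > 0" "C > 0"
    and B: "\<forall>\<^sub>F y in nhds x. \<bar>f y - f x\<bar> \<le> B * \<bar>y - x\<bar>"
    and C: "\<forall>\<^sub>F y in nhds x. \<bar>g y - g x\<bar> \<le> C * \<bar>y - x\<bar>"
    using assms by (auto simp: pointwise_lipschitz_def)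
  have "\<forall>\<^sub>F y in nhds x. \<bar>(f y - g y) - (f x - g x)\<bar> \<le> (B + C) * \<bar>y - x\<bar>"
    using B C
  proof eventually_elim
    case (elim y)
    then show ?case
      unfolding distrib_right by linarith
  qed
  then show ?thesis
    unfolding pointwise_lipschitz_def using \<open>B > 0\<close> \<open>C > 0\<close> by (intro exI[of _ "B + C"]) auto
qed

lemma pointwise_lipschitz_mult:
  assumes f: "pointwise_lipschitz f x" and g: "pointwise_lipschitz g x"
  shows "pointwise_lipschitz (\<lambda>y. f y * g y) x"
proof -
  obtain B C where BC: "B > 0" "C > 0"
    and B: "\<forall>\<^sub>F y in nhds x. \<bar>f y - f x\<bar> \<le> B * \<bar>y - x\<bar>"
    and C: "\<forall>\<^sub>F y in nhds x. \<bar>g y - g x\<bar> \<le> C * \<bar>y - x\<bar>"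
    using assms by (auto simp: pointwise_lipschitz_def)
  have "\<forall>\<^sub>F y in nhds x. dist (f y) (f x) < 1"
    using pointwise_lipschitz_imp_tendsto[OF f] by (rule tendstoD) simp
  then have "\<forall>\<^sub>F y in nhds x. \<bar>f y * g y - f x * g x\<bar> \<le> ((\<bar>f x\<bar> + 1) * C + \<bar>g x\<bar> * B) * \<bar>y - x\<bar>"
    using B C
  proof eventually_elim
    case (elim y)
    have "f y * g y - f x * g x = f y * (g y - g x) + g x * (f y - f x)"
      by (simp add: algebra_simps)
    then have "\<bar>f y * g y - f x * g x\<bar> \<le> \<bar>f y\<bar> * \<bar>g y - g x\<bar> + \<bar>g x\<bar> * \<bar>f y - f x\<bar>"
      by (metis abs_mult abs_triangle_ineq)
    also have "\<dots> \<le> (\<bar>f x\<bar> + 1) * (C * \<bar>y - x\<bar>) + \<bar>g x\<bar> * (B * \<bar>y - x\<bar>)"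
      using elim BC by (intro add_mono mult_mono) (auto simp: dist_real_def)
    finally show ?case
      by (simp add: algebra_simps)
  qed
  moreover have "0 < (\<bar>f x\<bar> + 1) * C + \<bar>g x\<bar> * B"
    using BC by (intro add_pos_nonneg) auto
  ultimately show ?thesis
    unfolding pointwise_lipschitz_def by blast
qed

lemma pointwise_lipschitz_compose:
  assumes f: "pointwise_lipschitz f x" and h: "pointwise_lipschitz h (f x)"
  shows "pointwise_lipschitz (\<lambda>y. h (f y)) x"
proof -
  obtain B C where BC: "B > 0" "C > 0"
    and B: "\<forall>\<^sub>F y in nhds x. \<bar>f y - f x\<bar> \<le> B * \<bar>y - x\<bar>"
    and C: "\<forall>\<^sub>F y in nhds (f x). \<bar>h y - h (f x)\<bar> \<le> C * \<bar>y - f x\<bar>"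
    using assms by (auto simp: pointwise_lipschitz_def)
  have "\<forall>\<^sub>F y in nhds x. \<bar>h (f y) - h (f x)\<bar> \<le> C * \<bar>f y - f x\<bar>"
    using eventually_compose_filterlim[OF C pointwise_lipschitz_imp_tendsto[OF f]] .
  then have "\<forall>\<^sub>F y in nhds x. \<bar>h (f y) - h (f x)\<bar> \<le> (C * B) * \<bar>y - x\<bar>"
    using B
  proof eventually_elim
    case (elim y)
    then show ?case
      using order_trans[OF elim(1) mult_left_mono[OF elim(2)]] BC by (simp add: mult.assoc)
  qed
  then show ?thesis
    unfolding pointwise_lipschitz_def using BC by (intro exI[of _ "C * B"]) auto
qed

text \<open>For \<open>e > 0\<close>, the function \<open>e * x - P x\<close> has a positive
  derivative off \<open>N\<close>, and the pointwise Lipschitz condition makes its image of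
  \<open>N\<close> negligible. So it does not decrease from \<open>a\<close> to \<open>b\<close>;
  then \<open>e\<close> tends to 0.\<close>

lemma antimono_if_deriv_nonpos_ae:
  fixes P :: "real \<Rightarrow> real"
  assumes "a \<le> b" and cont: "continuous_on {a..b} P" and N: "negligible N"
    and lip: "\<And>x. a < x \<Longrightarrow> x < b \<Longrightarrow> pointwise_lipschitz P x"
    and deriv: "\<And>x. a < x \<Longrightarrow> x < b \<Longrightarrow> x \<notin> N \<Longrightarrow> \<exists>D\<le>0. (P has_real_derivative D) (at x)"
  shows "P b \<le> P a"
proof -
  have *: "e * a - P a \<le> e * b - P b" if "e > 0" for e
  proof (rule le_if_frequently_increasing_right[OF \<open>a \<le> b\<close>, where P = "\<lambda>x. e * x - P x"])
    show "continuous_on {a..b} (\<lambda>x. e * x - P x)"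
      by (intro continuous_intros cont)
    show "negligible ((\<lambda>x. e * x - P x) ` (N \<inter> {a<..<b}))"
    proof (rule negligible_locally_Lipschitz_image)
      show "negligible (N \<inter> {a<..<b})"
        using N by (rule negligible_subset) auto
      fix x assume "x \<in> N \<inter> {a<..<b}"
      then have "pointwise_lipschitz (\<lambda>x. e * x - P x) x"
        by (intro pointwise_lipschitz_diff lip DERIV_imp_pointwise_lipschitz[of _ e])
          (auto intro!: derivative_eq_intros)
      then obtain B T where "open T" "x \<in> T"
          "\<And>y. y \<in> T \<Longrightarrow> \<bar>(e * y - P y) - (e * x - P x)\<bar> \<le> B * \<bar>y - x\<bar>"
        unfolding pointwise_lipschitz_def eventually_nhds by blast
      then show "\<exists>T B. open T \<and> x \<in> T \<and> (\<forall>y\<in>N \<inter> {a<..<b} \<inter> T.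
          norm ((e * y - P y) - (e * x - P x)) \<le> B * norm (y - x))"
        by (auto intro!: exI[of _ T] exI[of _ B])
    qed simp
    fix x assume x: "a < x" "x < b" "x \<notin> N \<inter> {a<..<b}"
    then obtain D where "D \<le> 0" and D: "(P has_real_derivative D) (at x)"
      using deriv[of x] by auto
    have "((\<lambda>x. e * x - P x) has_real_derivative e - D) (at x)"
      by (auto intro!: derivative_eq_intros D)
    then obtain d where "d > 0" "\<And>h. 0 < h \<Longrightarrow> h < d \<Longrightarrow> e * x - P x < e * (x + h) - P (x + h)"
      using DERIV_pos_inc_right \<open>D \<le> 0\<close> \<open>e > 0\<close> by fastforce
    then have "\<forall>\<^sub>F h in at_right 0. e * x - P x < e * (x + h) - P (x + h)"
      unfolding eventually_at_right_field by auto
    then show "\<exists>\<^sub>F h in at_right 0. e * x - P x < e * (x + h) - P (x + h)"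
      by (rule eventually_frequently[rotated]) simp
  qed
  show ?thesis
  proof (rule field_le_epsilon)
    fix e :: real assume "e > 0"
    have "e / (b - a + 1) * (b - a) \<le> e"
      using \<open>e > 0\<close> \<open>a \<le> b\<close> by (simp add: field_simps)
    then show "P b \<le> P a + e"
      using *[of "e / (b - a + 1)"] \<open>e > 0\<close> \<open>a \<le> b\<close> by (simp add: right_diff_distrib)
  qed
qed

section \<open>Radial functions in the plane\<close>

lemma norm_polar: "r \<ge> 0 \<Longrightarrow> norm (vector [r * cos t, r * sin t] :: real ^ 2) = r"
proof -
  assume "r \<ge> 0"
  have "(r * cos t)\<^sup>2 + (r * sin t)\<^sup>2 = r\<^sup>2 * ((cos t)\<^sup>2 + (sin t)\<^sup>2)"
    unfolding power_mult_distrib distrib_left ..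
  then show ?thesis
    using \<open>r \<ge> 0\<close> by (simp add: norm_vec_def L2_set_def sum_2)
qed

lemma circle_integral_radial:
  assumes "r \<ge> 0" and "\<And>x. norm x = r \<Longrightarrow> f x = c"
  shows "circle_integral r f = 2 * pi * r * c"
  unfolding circle_integral_def assms(2)[OF norm_polar[OF assms(1)]]
  by (simp add: set_integral_const)

lemma grad_eq:
  assumes "GDERIV f x :> D"
  shows "grad f x = D"
  unfolding grad_def
proof (rule the_equality)
  show "GDERIV f x :> D"
    by (rule assms)
next
  fix D' assume "GDERIV f x :> D'"
  then have "(\<lambda>h. h \<bullet> D') = (\<lambda>h. h \<bullet> D)"
    using assms unfolding gderiv_def by (rule has_derivative_unique)
  then show "D' = D"
    by (metis vector_eq_ldot)
qed

text \<open>The radial formula is known only where \<open>R < norm x\<close>, but that region is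
  open, so the chain rule for \<open>g (norm x)\<close> carries over to \<open>f\<close>.\<close>

lemma GDERIV_radial:
  fixes f :: "'a :: real_inner \<Rightarrow> real"
  assumes "\<And>x. R < norm x \<Longrightarrow> f x = g (norm x)" and "0 \<le> R" "R < norm x"
    and "(g has_real_derivative D) (at (norm x))"
  shows "GDERIV f x :> D *\<^sub>R sgn x"
proof -
  have "GDERIV (\<lambda>x. g (norm x)) x :> D *\<^sub>R sgn x"
    using assms by (intro GDERIV_DERIV_compose GDERIV_norm) auto
  moreover have "open {y :: 'a. R < norm y}"
    by (intro open_Collect_less continuous_intros)
  ultimately show ?thesis
    unfolding gderiv_def using assms(1,3)
    by (elim has_derivative_transform_within_open) auto
qed

section \<open>Tail integrals of decreasing radial functions\<close>

context
  fixes u :: "real ^ 2 \<Rightarrow> real" and w :: "real \<Rightarrow> real" and R :: real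
  assumes R: "R \<ge> 0"
    and int: "set_integrable lborel (- ball 0 R) u"
    and radial: "\<And>x. R \<le> norm x \<Longrightarrow> u x = w (norm x)"
    and antimono: "antimono_on {R..} w"
    and nonneg: "\<And>r. R \<le> r \<Longrightarrow> 0 \<le> w r"
begin

private abbreviation (input) tail :: "real \<Rightarrow> real" where
  "tail r \<equiv> LINT x:- ball 0 r|lborel. u x"

text \<open>Comparison with the area of an annulus gives the derivative of the tail without polar coordinates.\<close>

lemma tail_diff_bounds:
  assumes "R \<le> r" "r \<le> s"
  shows "pi * (s\<^sup>2 - r\<^sup>2) * w s \<le> tail r - tail s" "tail r - tail s \<le> pi * (s\<^sup>2 - r\<^sup>2) * w r"
proof -
  define A where "A = ball (0 :: real ^ 2) s - ball 0 r"
  have [simp]: "A \<in> sets borel"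
    by (simp add: A_def)
  have int_A: "set_integrable lborel A u" and int_s: "set_integrable lborel (- ball 0 s) u"
    using assms by (auto simp: A_def intro!: set_integrable_subset[OF int])
  have "measure lborel A = measure lborel (ball (0 :: real ^ 2) s) - measure lborel (ball (0 :: real ^ 2) r)"
    unfolding A_def using assms
    using emeasure_lborel_ball_finite[of "0 :: real ^ 2" s] by (intro measure_Diff) auto
  also have "\<dots> = pi * (s\<^sup>2 - r\<^sup>2)"
    using assms R by (simp add: circle_area algebra_simps)
  finally have area: "measure lborel A = pi * (s\<^sup>2 - r\<^sup>2)" .
  have fin: "emeasure lborel A \<noteq> \<infinity>"
    using emeasure_bounded_finite[OF bounded_subset[OF bounded_ball, of A 0 s]] by (auto simp: A_def)
  have const: "(LINT x:A|lborel. c) = pi * (s\<^sup>2 - r\<^sup>2) * c" for c :: real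
    using set_integral_const[of A lborel c] fin area by simp
  have int_const: "set_integrable lborel A (\<lambda>_. c)" for c :: real
    using fin by (simp add: set_integrable_def less_top)
  have "- ball 0 r = A \<union> - ball 0 s" "A \<inter> - ball 0 s = {}"
    using assms by (auto simp: A_def)
  then have diff: "tail r - tail s = (LINT x:A|lborel. u x)"
    using set_integral_Un[OF _ int_A int_s] by simp
  have w: "w s \<le> u x" "u x \<le> w r" if "x \<in> A" for x
    using that assms radial[of x] monotone_onD[OF antimono, of "norm x" s]
      monotone_onD[OF antimono, of r "norm x"] by (auto simp: A_def)
  show "pi * (s\<^sup>2 - r\<^sup>2) * w s \<le> tail r - tail s"
    unfolding diff const[symmetric] using w int_A int_const by (intro set_integral_mono) auto
  show "tail r - tail s \<le> pi * (s\<^sup>2 - r\<^sup>2) * w r"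
    unfolding diff const[symmetric] using w int_A int_const by (intro set_integral_mono) auto
qed

lemma tail_tendsto_0: "(tail \<longlongrightarrow> 0) at_top"
proof -
  \<comment> \<open>Integrability is known only outside \<open>ball 0 R\<close>, so the radius is
    cut off at \<open>R\<close> to have a dominating function for every \<open>r\<close>; the cutoff
    disappears for large \<open>r\<close>.\<close>
  have "((\<lambda>r. tail (max R r)) \<longlongrightarrow> (\<integral>x. 0 \<partial>(lborel :: (real ^ 2) measure))) at_top"
    unfolding set_lebesgue_integral_def
  proof (rule integral_dominated_convergence_at_top)
    show "integrable lborel (\<lambda>x. norm (indicat_real (- ball 0 R) x *\<^sub>R u x))"
      using int by (intro integrable_norm) (simp add: set_integrable_def)
    show "(\<lambda>x. indicat_real (- ball 0 (max R r)) x *\<^sub>R u x) \<in> borel_measurable lborel" for r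
    proof -
      have "set_integrable lborel (- ball 0 (max R r)) u"
        by (rule set_integrable_subset[OF int]) auto
      then show ?thesis
        unfolding set_integrable_def by (rule borel_measurable_integrable)
    qed
    show "\<forall>\<^sub>F r in at_top. AE x in lborel. norm (indicat_real (- ball 0 (max R r)) x *\<^sub>R u x)
        \<le> norm (indicat_real (- ball 0 R) x *\<^sub>R u x)"
      by (intro always_eventually allI AE_I2) (auto simp: indicator_def)
    show "AE x in lborel. ((\<lambda>r. indicat_real (- ball 0 (max R r)) x *\<^sub>R u x) \<longlongrightarrow> 0) at_top"
    proof (rule AE_I2)
      fix x :: "real ^ 2"
      have "\<forall>\<^sub>F r in at_top. indicat_real (- ball 0 (max R r)) x *\<^sub>R u x = 0"
        using eventually_gt_at_top[of "norm x"] by eventually_elim (auto simp: indicator_def)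
      then show "((\<lambda>r. indicat_real (- ball 0 (max R r)) x *\<^sub>R u x) \<longlongrightarrow> 0) at_top"
        by (rule tendsto_eventually)
    qed
  qed simp
  moreover have "\<forall>\<^sub>F r in at_top. tail (max R r) = tail r"
    using eventually_ge_at_top[of R] by eventually_elim (simp add: max_def)
  ultimately show ?thesis
    by (simp add: filterlim_cong)
qed

lemma tail_continuous_on: "continuous_on {R..b} tail"
proof (rule lipschitz_on_continuous_on)
  \<comment> \<open>From \<open>s\<^sup>2 - r\<^sup>2 = (s + r) * (s - r)\<close> with
    \<open>s + r \<le> 2 * \<bar>b\<bar>\<close>, and \<open>w r \<le> w R\<close> on the
    annulus.\<close>
  define C where "C = pi * (2 * \<bar>b\<bar>) * w R"
  show "C-lipschitz_on {R..b} tail"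
  proof (rule lipschitz_onI)
    have *: "dist (tail r) (tail s) \<le> C * dist r s" if rs: "R \<le> r" "r \<le> s" "s \<le> b" for r s
    proof -
      have "s\<^sup>2 - r\<^sup>2 = (s + r) * (s - r)"
        by (simp add: algebra_simps power2_eq_square)
      have "0 \<le> pi * (s\<^sup>2 - r\<^sup>2) * w s"
        using rs R nonneg[of s] by (intro mult_nonneg_nonneg) (auto simp: power_mono)
      moreover have "pi * (s\<^sup>2 - r\<^sup>2) * w r \<le> pi * (s\<^sup>2 - r\<^sup>2) * w R"
        using rs R monotone_onD[OF antimono, of R r] by (intro mult_left_mono) (auto simp: power_mono)
      moreover have "pi * (s\<^sup>2 - r\<^sup>2) * w R \<le> pi * (2 * \<bar>b\<bar> * (s - r)) * w R"
        unfolding \<open>s\<^sup>2 - r\<^sup>2 = _\<close>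
        using rs R nonneg[of R] by (intro mult_right_mono mult_left_mono) auto
      ultimately have "0 \<le> tail r - tail s" "tail r - tail s \<le> pi * (2 * \<bar>b\<bar> * (s - r)) * w R"
        using tail_diff_bounds[OF rs(1,2)] by linarith+
      moreover have "pi * (2 * \<bar>b\<bar> * (s - r)) * w R = C * (s - r)"
        by (simp add: C_def)
      ultimately show ?thesis
        using rs by (simp add: dist_real_def)
    qed
    show "dist (tail r) (tail s) \<le> C * dist r s" if "r \<in> {R..b}" "s \<in> {R..b}" for r s
      using *[of r s] *[of s r] that by (cases r s rule: le_cases) (auto simp: dist_commute)
  qed (use nonneg[of R] in \<open>simp add: C_def\<close>)
qed

text \<open>Dividing the annulus bounds by \<open>y - r\<close> turns the area factor into
  \<open>pi * (y + r)\<close>. The maximum and minimum of \<open>w r\<close> and \<open>w y\<close>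
  state the bounds uniformly for \<open>y\<close> on either side of \<open>r\<close>, and continuity
  of \<open>w\<close> makes them meet.\<close>

lemma tail_deriv:
  assumes "R < r" "isCont w r"
  shows "(tail has_real_derivative - (2 * pi * r * w r)) (at r)"
  unfolding has_field_derivative_iff
proof (rule tendsto_sandwich)
  have "((\<lambda>y. - (pi * (y + r) * max (w r) (w y))) \<longlongrightarrow> - (pi * (r + r) * max (w r) (w r))) (at r)"
       "((\<lambda>y. - (pi * (y + r) * min (w r) (w y))) \<longlongrightarrow> - (pi * (r + r) * min (w r) (w r))) (at r)"
    using assms(2) unfolding isCont_def by (intro tendsto_intros; assumption)+
  then show "((\<lambda>y. - (pi * (y + r) * max (w r) (w y))) \<longlongrightarrow> - (2 * pi * r * w r)) (at r)"
       "((\<lambda>y. - (pi * (y + r) * min (w r) (w y))) \<longlongrightarrow> - (2 * pi * r * w r)) (at r)"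
    by (simp_all add: algebra_simps)
  have *: "\<forall>\<^sub>F y in at r. y \<in> {R<..} \<and> y \<noteq> r"
    using assms(1) by (intro eventually_conj eventually_at_in_open' eventually_neq_at_within) auto
  have "- (pi * (y + r) * max (w r) (w y)) \<le> (tail y - tail r) / (y - r) \<and>
      (tail y - tail r) / (y - r) \<le> - (pi * (y + r) * min (w r) (w y))" if "R < y" "y \<noteq> r" for y
  proof (cases "r < y")
    case True
    then have "w y \<le> w r"
      using monotone_onD[OF antimono, of r y] assms by auto
    then show ?thesis
      using True tail_diff_bounds[of r y] assms
      by (simp add: max_def min_def field_simps power2_eq_square)
  next
    case False
    then have "w r \<le> w y"
      using monotone_onD[OF antimono, of y r] that by auto
    then show ?thesis
      using False tail_diff_bounds[of y r] assms that
      by (simp add: max_def min_def field_simps power2_eq_square)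
  qed
  then show "\<forall>\<^sub>F y in at r. - (pi * (y + r) * max (w r) (w y)) \<le> (tail y - tail r) / (y - r)"
       "\<forall>\<^sub>F y in at r. (tail y - tail r) / (y - r) \<le> - (pi * (y + r) * min (w r) (w y))"
    using * by (auto elim!: eventually_mono)
qed

end

section \<open>The inequality\<close>

theorem proposition3p1:
  fixes R :: real and \<psi> :: "real ^ 2 \<Rightarrow> real"
  assumes "R > 0"
    and "\<exists>L. L-lipschitz_on (- ball 0 R) \<psi>"
    and "strictly_decreasing_radial_on (- ball 0 R) \<psi>"
    and "AE r in lborel. r \<in> {R<..} \<longrightarrow>
           circle_integral r (\<lambda>x. norm (grad \<psi> x))
             \<le> 8 * pi - (LINT x:(- ball 0 r)|lborel. exp (\<psi> x))"
    and "set_integrable lborel (- ball 0 R) (\<lambda>x. exp (\<psi> x))"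
    and "(LINT x:(- ball 0 R)|lborel. exp (\<psi> x)) < 8 * pi"
  shows "(circle_integral R (\<lambda>x. exp (\<psi> x / 2)))\<^sup>2
           \<le> 1 / 2 * (LINT x:(- ball 0 R)|lborel. exp (\<psi> x))
               * (8 * pi - (LINT x:(- ball 0 R)|lborel. exp (\<psi> x)))
       \<and> (\<not> (AE r in lborel. r \<in> {R<..} \<longrightarrow>
               circle_integral r (\<lambda>x. norm (grad \<psi> x))
                 = 8 * pi - (LINT x:(- ball 0 r)|lborel. exp (\<psi> x)))
          \<longrightarrow> (circle_integral R (\<lambda>x. exp (\<psi> x / 2)))\<^sup>2
                < 1 / 2 * (LINT x:(- ball 0 R)|lborel. exp (\<psi> x))
                    * (8 * pi - (LINT x:(- ball 0 R)|lborel. exp (\<psi> x))))"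
proof -
  let ?E = "- ball (0 :: real ^ 2) R"

  \<comment> \<open>The radial profile of \<open>\<psi>\<close>\<close>
  obtain L where lip: "L-lipschitz_on ?E \<psi>"
    using assms(2) by blast
  have img: "norm ` ?E = {R..}"
  proof (intro equalityI subsetI)
    fix r assume "r \<in> {R..}"
    moreover obtain x :: "real ^ 2" where "norm x = r"
      using vector_choose_size[of r] calculation \<open>R > 0\<close> by auto
    ultimately show "r \<in> norm ` ?E"
      by (auto intro!: image_eqI[of _ _ x])
  qed auto
  obtain g where g: "\<And>x. R \<le> norm x \<Longrightarrow> \<psi> x = g (norm x)" and dec: "strict_antimono_on {R..} g"
    using assms(3) unfolding strictly_decreasing_radial_on_def img by force
  have g_le: "g s \<le> g r" if "R \<le> r" "r \<le> s" for r s
    using monotone_onD[OF dec, of r s] that by (cases "r = s") auto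
  have g_lip: "\<bar>g r - g s\<bar> \<le> L * \<bar>r - s\<bar>" if "R \<le> r" "R \<le> s" for r s
  proof -
    obtain e :: "real ^ 2" where e: "norm e = 1"
      using vector_choose_size[of 1] by auto
    have "dist (\<psi> (r *\<^sub>R e)) (\<psi> (s *\<^sub>R e)) \<le> L * dist (r *\<^sub>R e) (s *\<^sub>R e)"
      using that \<open>R > 0\<close> e by (intro lipschitz_onD[OF lip]) auto
    moreover have "dist (r *\<^sub>R e) (s *\<^sub>R e) = \<bar>r - s\<bar>"
      using e by (simp add: dist_norm flip: scaleR_left_diff_distrib)
    ultimately show ?thesis
      using that \<open>R > 0\<close> e g[of "r *\<^sub>R e"] g[of "s *\<^sub>R e"] by (simp add: dist_real_def)
  qed

  \<comment> \<open>Negating the profile and freezing it at its value for \<open>R\<close> gives a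
    monotone Lipschitz function on the whole line, as the differentiability theorem demands; beyond
    \<open>R\<close> its derivative is minus that of \<open>g\<close>.\<close>
  define f where "f r = - g (max R r)" for r
  have f_mono: "mono f"
    by (intro monoI) (auto simp: f_def intro!: g_le)
  have f_lip: "L-lipschitz_on UNIV f"
  proof (rule lipschitz_onI)
    show "L \<ge> 0"
      using lip by (rule lipschitz_on_nonneg)
    then have "L * \<bar>max R r - max R s\<bar> \<le> L * \<bar>r - s\<bar>" for r s
      by (intro mult_left_mono) auto
    then show "dist (f r) (f s) \<le> L * dist r s" for r s
      using order_trans[OF g_lip[of "max R r" "max R s"]] by (simp add: f_def dist_real_def abs_minus_commute)
  qed
  define N where "N = {r. \<not> f differentiable at r}"
  have N: "negligible N"
    unfolding N_def using f_mono f_lip by (rule mono_lipschitz_differentiable_ae)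

  define w where "w r = exp (- f r)" for r
  have w_eq: "w r = exp (g r)" if "R \<le> r" for r
    using that by (simp add: w_def f_def)
  have w_cont: "continuous_on UNIV w"
    unfolding w_def by (intro continuous_intros lipschitz_on_continuous_on[OF f_lip])
  have w_radial: "exp (\<psi> x) = w (norm x)" if "R \<le> norm x" for x
    using that by (simp add: w_eq g)
  have w_antimono: "antimono_on {R..} w"
    using f_mono by (auto simp: w_def monotone_on_def)
  have w_nonneg: "0 \<le> w r" for r
    by (simp add: w_def)

  \<comment> \<open>Tail mass and the deficit function \<open>P\<close>\<close>
  define F where "F r = (LINT x:- ball 0 r|lborel. exp (\<psi> x))" for r
  have "R \<ge> 0"
    using \<open>R > 0\<close> by simp
  note tail = this assms(5) w_radial w_antimono w_nonneg
  have F_deriv: "(F has_real_derivative - (2 * pi * r * w r)) (at r)" if "R < r" for r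
    unfolding F_def using tail_deriv[OF tail that] w_cont continuous_on_eq_continuous_at[of UNIV w] by simp
  have F_lim: "(F \<longlongrightarrow> 0) at_top"
    unfolding F_def by (rule tail_tendsto_0[OF tail])

  \<comment> \<open>The difference of the two sides of the claim, taken at radius \<open>r\<close>:
    the subtracted term is the squared circle integral of \<open>exp (\<psi> x / 2)\<close>.\<close>
  define P where "P r = F r * (8 * pi - F r) / 2 - 4 * pi\<^sup>2 * (r\<^sup>2 * w r)" for r
  have P_deriv: "(P has_real_derivative 2 * pi * r * w r * (F r - 8 * pi + 2 * pi * r * D)) (at r)"
    if "R < r" and D: "(f has_real_derivative D) (at r)" for r D
  proof -
    have "(w has_real_derivative - D * w r) (at r)"
      unfolding w_def by (auto intro!: derivative_eq_intros D)
    then show ?thesis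
      unfolding P_def
      by (auto intro!: derivative_eq_intros F_deriv[OF \<open>R < r\<close>] simp: field_simps power2_eq_square)
  qed
  \<comment> \<open>On the null set where \<open>f\<close> is not differentiable, this condition
    controls the image of \<open>P\<close>.\<close>
  have P_lip: "pointwise_lipschitz P r" if "R < r" for r
  proof -
    have "pointwise_lipschitz w r"
      unfolding w_def
      by (intro pointwise_lipschitz_compose[of f r "\<lambda>z. exp (- z)"] lipschitz_imp_pointwise_lipschitz[OF f_lip]
          DERIV_imp_pointwise_lipschitz[of _ "- exp (- f r)"]) (auto intro!: derivative_eq_intros)
    moreover have "pointwise_lipschitz (\<lambda>r. F r * (8 * pi - F r) / 2) r"
      by (rule DERIV_imp_pointwise_lipschitz) (rule derivative_eq_intros F_deriv[OF that] refl | simp)+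
    moreover have "pointwise_lipschitz (\<lambda>r. 4 * pi\<^sup>2 * r\<^sup>2) r"
      by (rule DERIV_imp_pointwise_lipschitz) (rule derivative_eq_intros refl | simp)+
    ultimately have "pointwise_lipschitz (\<lambda>r. F r * (8 * pi - F r) / 2 - (4 * pi\<^sup>2 * r\<^sup>2) * w r) r"
      by (intro pointwise_lipschitz_diff pointwise_lipschitz_mult[where f = "\<lambda>r. 4 * pi\<^sup>2 * r\<^sup>2"])
    then show ?thesis
      unfolding P_def by (simp add: mult.assoc)
  qed
  have P_cont: "continuous_on {R..b} P" for b
    unfolding P_def F_def
    by (intro continuous_intros tail_continuous_on[OF tail] continuous_on_subset[OF w_cont]) auto

  \<comment> \<open>The annulus between \<open>r / 2\<close> and \<open>r\<close> has area
    \<open>3 / 4 * pi * r\<^sup>2\<close> and carries density at least \<open>w r\<close>, so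
    \<open>r\<^sup>2 * w r\<close> is bounded by a multiple of \<open>F (r / 2) - F r\<close>, which
    tends to 0.\<close>
  have P_lim: "(P \<longlongrightarrow> 0) at_top"
  proof -
    have F_half: "((\<lambda>r. F (r / 2)) \<longlongrightarrow> 0) at_top"
      by (rule filterlim_compose[OF F_lim]) real_asymp
    have "((\<lambda>r. 4 / (3 * pi) * (F (r / 2) - F r)) \<longlongrightarrow> 4 / (3 * pi) * (0 - 0)) at_top"
      by (intro tendsto_intros F_half F_lim)
    then have lim: "((\<lambda>r. 4 / (3 * pi) * (F (r / 2) - F r)) \<longlongrightarrow> 0) at_top"
      by simp
    have "r\<^sup>2 * w r \<le> 4 / (3 * pi) * (F (r / 2) - F r)" if "2 * R \<le> r" for r
    proof -
      have "pi * (r\<^sup>2 - (r / 2)\<^sup>2) * w r \<le> F (r / 2) - F r"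
        using that \<open>R > 0\<close> unfolding F_def by (intro tail_diff_bounds(1)[OF tail]) auto
      then have "4 / (3 * pi) * (pi * (r\<^sup>2 - (r / 2)\<^sup>2) * w r) \<le> 4 / (3 * pi) * (F (r / 2) - F r)"
        by (intro mult_left_mono) auto
      moreover have "4 / (3 * pi) * (pi * (r\<^sup>2 - (r / 2)\<^sup>2) * w r) = r\<^sup>2 * w r"
        by (simp add: power_divide)
      ultimately show ?thesis
        by linarith
    qed
    then have "\<forall>\<^sub>F r in at_top. r\<^sup>2 * w r \<le> 4 / (3 * pi) * (F (r / 2) - F r)"
      by (rule eventually_mono[OF eventually_ge_at_top])
    moreover have "\<forall>\<^sub>F r in at_top. 0 \<le> r\<^sup>2 * w r"
      using w_nonneg by simp
    ultimately have "((\<lambda>r. r\<^sup>2 * w r) \<longlongrightarrow> 0) at_top"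
      by (intro tendsto_sandwich[OF _ _ tendsto_const lim])
    then have "(P \<longlongrightarrow> 0 * (8 * pi - 0) / 2 - 4 * pi\<^sup>2 * 0) at_top"
      unfolding P_def by (intro tendsto_intros F_lim) simp
    then show ?thesis
      by simp
  qed

  \<comment> \<open>Where \<open>f\<close> is differentiable at \<open>r\<close>,
    \<open>\<psi>\<close> is differentiable on the whole circle, so \<open>grad\<close> has no junk
    value there. Monotonicity of \<open>f\<close> gives \<open>D \<ge> 0\<close>, which removes the
    absolute value.\<close>
  have flux: "circle_integral r (\<lambda>x. norm (grad \<psi> x)) = 2 * pi * r * D"
    if r: "R < r" and D: "(f has_real_derivative D) (at r)" for r D
  proof (rule circle_integral_radial)
    fix x :: "real ^ 2" assume x: "norm x = r"
    have "GDERIV \<psi> x :> (- D) *\<^sub>R sgn x"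
    proof (rule GDERIV_radial[where g = "\<lambda>r. - f r" and R = R])
      show "\<psi> y = - f (norm y)" if "R < norm y" for y
        using that g[of y] by (simp add: f_def)
      show "((\<lambda>r. - f r) has_real_derivative - D) (at (norm x))"
        unfolding x by (intro derivative_intros D)
    qed (use r x \<open>R > 0\<close> in auto)
    moreover have "D \<ge> 0"
      using mono_on_imp_deriv_nonneg[OF f_mono D] by simp
    ultimately show "norm (grad \<psi> x) = D"
      using r x \<open>R > 0\<close> by (auto simp: grad_eq norm_sgn)
  qed (use r \<open>R > 0\<close> in auto)

  \<comment> \<open>Monotonicity of \<open>P\<close> and the equality case\<close>
  obtain M where M: "negligible M"
    and le: "\<And>r. R < r \<Longrightarrow> r \<notin> M \<Longrightarrow> circle_integral r (\<lambda>x. norm (grad \<psi> x)) \<le> 8 * pi - F r"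
    using AE_completion[OF assms(4)] unfolding eventually_ae_filter_negligible F_def by blast
  have P_antimono: "P b \<le> P a" if "R \<le> a" "a \<le> b" for a b
  proof (rule antimono_if_deriv_nonpos_ae[OF \<open>a \<le> b\<close>])
    show "negligible (N \<union> M)"
      using N M by (rule negligible_Un)
    show "continuous_on {a..b} P"
      using P_cont by (rule continuous_on_subset) (use that in auto)
    fix r assume r: "a < r" "r < b"
    then show "pointwise_lipschitz P r"
      using P_lip that by simp
    assume "r \<notin> N \<union> M"
    then obtain D where D: "(f has_real_derivative D) (at r)"
      unfolding N_def by (auto simp: real_differentiable_def)
    have "F r - 8 * pi + 2 * pi * r * D \<le> 0"
      using le[of r] flux[of r D] D r that \<open>r \<notin> N \<union> M\<close> by simp
    then have "2 * pi * r * w r * (F r - 8 * pi + 2 * pi * r * D) \<le> 0"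
      using r that \<open>R > 0\<close> w_nonneg[of r] by (intro mult_nonneg_nonpos) auto
    then show "\<exists>D\<le>0. (P has_real_derivative D) (at r)"
      using P_deriv[OF _ D] r that by (meson le_less_trans)
  qed
  have P_nonneg: "P a \<ge> 0" if "R \<le> a" for a
  proof (rule tendsto_upperbound[OF P_lim])
    show "\<forall>\<^sub>F r in at_top. P r \<le> P a"
      using eventually_ge_at_top[of a] by (rule eventually_mono) (use that in \<open>auto intro: P_antimono\<close>)
  qed simp
  have circle: "(circle_integral R (\<lambda>x. exp (\<psi> x / 2)))\<^sup>2 = 4 * pi\<^sup>2 * (R\<^sup>2 * w R)"
  proof -
    have "circle_integral R (\<lambda>x. exp (\<psi> x / 2)) = 2 * pi * R * exp (g R / 2)"
      using \<open>R > 0\<close> g by (intro circle_integral_radial) auto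
    moreover have "(exp (g R / 2))\<^sup>2 = w R"
      by (simp add: w_eq flip: exp_double)
    ultimately show ?thesis
      by (simp add: power_mult_distrib)
  qed
  have "AE r in lborel. r \<in> {R<..} \<longrightarrow>
      circle_integral r (\<lambda>x. norm (grad \<psi> x)) = 8 * pi - F r" if "P R = 0"
  proof -
    have "circle_integral r (\<lambda>x. norm (grad \<psi> x)) = 8 * pi - F r" if r: "R < r" "r \<notin> N" for r
    proof -
      obtain D where D: "(f has_real_derivative D) (at r)"
        using r unfolding N_def by (auto simp: real_differentiable_def)
      have "P y = 0" if "y \<in> {R<..}" for y
        using P_antimono[of R y] P_nonneg[of y] that \<open>P R = 0\<close> by simp
      then have "((\<lambda>_. 0) has_real_derivative 2 * pi * r * w r * (F r - 8 * pi + 2 * pi * r * D)) (at r)"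
        using has_field_derivative_transform_within_open[OF P_deriv[OF r(1) D], of "{R<..}"] r by simp
      then have "2 * pi * r * w r * (F r - 8 * pi + 2 * pi * r * D) = 0"
        using DERIV_unique DERIV_const by blast
      \<comment> \<open>The factor \<open>2 * pi * r * w r\<close> is positive, so the bracket
        vanishes, and that is equality in the flux condition.\<close>
      then show ?thesis
        using flux[OF r(1) D] r \<open>R > 0\<close> by (simp add: w_def)
    qed
    then have "AE r in lebesgue. r \<in> {R<..} \<longrightarrow> circle_integral r (\<lambda>x. norm (grad \<psi> x)) = 8 * pi - F r"
      unfolding eventually_ae_filter_negligible using N by (intro exI[of _ N]) auto
    then show ?thesis
      by (simp add: AE_completion_iff)
  qed
  \<comment> \<open>Strictness is the contrapositive: equality in the claim means
    \<open>P R = 0\<close>, which forces equality of the flux almost everywhere.\<close>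
  then show ?thesis
    using P_nonneg[of R] unfolding circle F_def[symmetric] P_def
    by (auto simp: less_le)
qed

end
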